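(* Let $U\subseteq\mathbb{R}^N$ be open and let $F:U\to\mathbb{R}^M$ be a $C^1$ function that has almost constant rank (ACR). Then either (a) $\operatorname{SolSet}(p)$ is robust for Lebesgue almost every $p\in U$, or (b) $\operatorname{SolSet}(p)$ is robust for no $p\in U$.
   Context: $DF(x)$ is the $M\times N$ Jacobian matrix of $F$ at $x$. $F$ has almost constant rank (is ACR) if there is an integer $\rho\ge 0$ such that $\operatorname{rank}(DF(x))=\rho$ for Lebesgue almost every $x\in U$. For $p\in U$, $\operatorname{SolSet}(p)=\{x\in U:F(x)=F(p)\}$. A point $p\in U$ is robust for $F$ if $DF(p)$ has rank $M$, and fragile otherwise. "$\operatorname{SolSet}(p)$ is robust" means that the point $p$ is robust for $F$, i.e. $\operatorname{rank}(DF(p))=M$. *)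

theory Defs
  imports "HOL-Analysis.Analysis"
begin

text \<open>
  A map \<open>F : U \<rightarrow> \<real>\<^sup>M\<close>, with \<open>U\<close> open in \<open>\<real>\<^sup>N\<close>, is represented by a total function together
  with the set \<open>U\<close>; since \<open>U\<close> is open, \<open>jacobian F (at x)\<close> for \<open>x \<in> U\<close> depends only on the
  restriction of \<open>F\<close> to \<open>U\<close>.
\<close>

definition C1_on :: "(real^'n \<Rightarrow> real^'m) \<Rightarrow> (real^'n) set \<Rightarrow> bool" where
  "C1_on F U \<longleftrightarrow>
     (\<forall>x\<in>U. F differentiable (at x)) \<and> continuous_on U (\<lambda>x. jacobian F (at x))"

definition almost_constant_rank :: "(real^'n \<Rightarrow> real^'m) \<Rightarrow> (real^'n) set \<Rightarrow> bool" where
  "almost_constant_rank F U \<longleftrightarrow>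
     (\<exists>\<rho>::nat. AE x in lebesgue_on U. rank (jacobian F (at x)) = \<rho>)"

definition sol_set :: "(real^'n \<Rightarrow> real^'m) \<Rightarrow> (real^'n) set \<Rightarrow> real^'n \<Rightarrow> (real^'n) set" where
  "sol_set F U p = {x \<in> U. F x = F p}"

definition robust_point :: "(real^'n \<Rightarrow> real^'m) \<Rightarrow> (real^'n) set \<Rightarrow> real^'n \<Rightarrow> bool" where
  "robust_point F U p \<longleftrightarrow> p \<in> U \<and> rank (jacobian F (at p)) = CARD('m)"

text \<open>
  The phrase ``the solution set \<open>sol_set F U p\<close> is robust'' refers to the base point \<open>p\<close>: it
  means that \<open>p\<close> is a robust point. It is not a property of the set alone, since \<open>p\<close> and \<open>q\<close>
  with \<open>sol_set F U p = sol_set F U q\<close> may differ in robustness.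
\<close>

definition sol_set_robust :: "(real^'n \<Rightarrow> real^'m) \<Rightarrow> (real^'n) set \<Rightarrow> real^'n \<Rightarrow> bool" where
  "sol_set_robust F U p \<longleftrightarrow> robust_point F U p"

end

theory Submission
  imports Defs
begin

text \<open>Full row rank is an open condition on a continuous matrix field
  (\<open>open_full_row_rank\<close>), so a single robust point yields a nonempty open set
  \<open>V\<close> of robust points. Such a set is not Lebesgue null, hence it meets the
  almost-everywhere set on which the Jacobian has the constant rank \<open>\<rho>\<close>
  (\<open>AE_lebesgue_on_open_meets\<close>). A common point forces
  \<open>\<rho> = CARD('m)\<close>, so almost every point of \<open>U\<close> is robust: one robust
  point already gives the first alternative.\<close>

lemma continuous_on_det_matrix_mult:
  fixes J :: "'a::topological_space \<Rightarrow> real^'n^'m" and B :: "real^'m^'n"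
  assumes "continuous_on U J"
  shows "continuous_on U (\<lambda>x. det (J x ** B))"
  unfolding det_def matrix_matrix_mult_def
  by (auto intro!: continuous_intros assms)

lemma full_row_rank_iff_right_invertible:
  fixes A :: "real^'n^'m"
  shows "rank A = CARD('m) \<longleftrightarrow> (\<exists>B::real^'m^'n. A ** B = mat 1)"
  by (simp add: full_rank_surjective matrix_right_invertible_surjective)

text \<open>If \<open>C\<close> inverts \<open>A ** B\<close>, then \<open>B ** C\<close> is a right
  inverse of \<open>A\<close>. Thus a fixed \<open>B\<close> turns full rank of a rectangular matrix
  into a determinant test.\<close>

lemma full_row_rank_if_det_mult_nonzero:
  fixes A :: "real^'n^'m" and B :: "real^'m^'n"
  assumes "det (A ** B) \<noteq> 0"
  shows "rank A = CARD('m)"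
proof -
  obtain C where "(A ** B) ** C = mat 1"
    using assms invertible_det_nz[of "A ** B"] unfolding invertible_def by blast
  then have "A ** (B ** C) = mat 1"
    by (simp add: matrix_mul_assoc)
  then show ?thesis
    unfolding full_row_rank_iff_right_invertible by blast
qed

text \<open>If \<open>B\<close> is a right inverse of \<open>J p\<close>, then \<open>det (J x ** B) \<noteq> 0\<close> persists near \<open>p\<close>.\<close>

lemma open_full_row_rank:
  fixes J :: "'a::topological_space \<Rightarrow> real^'n^'m"
  assumes "open U" and "continuous_on U J"
  shows "open {x \<in> U. rank (J x) = CARD('m)}"
proof (subst open_subopen, intro ballI)
  fix p assume "p \<in> {x \<in> U. rank (J x) = CARD('m)}"
  then obtain B :: "real^'m^'n" where p: "p \<in> U" and B: "J p ** B = mat 1"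
    using full_row_rank_iff_right_invertible[of "J p"] by auto
  define V where "V = U \<inter> (\<lambda>x. det (J x ** B)) -` (- {0})"
  have "open V"
    unfolding V_def using assms continuous_on_det_matrix_mult
    by (intro continuous_open_preimage) auto
  moreover have "p \<in> V"
    using p B by (simp add: V_def)
  moreover have "V \<subseteq> {x \<in> U. rank (J x) = CARD('m)}"
    by (auto simp: V_def intro: full_row_rank_if_det_mult_nonzero)
  ultimately show "\<exists>T. open T \<and> p \<in> T \<and> T \<subseteq> {x \<in> U. rank (J x) = CARD('m)}"
    by blast
qed

text \<open>The points of \<open>U\<close> where \<open>P\<close> fails lie in a null set, and a
  nonempty open set is too large to fit inside one.\<close>

lemma AE_lebesgue_on_open_meets:
  fixes U V :: "'a::euclidean_space set"
  assumes "AE x in lebesgue_on U. P x" and "open U" "open V" "V \<subseteq> U" "V \<noteq> {}"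
  obtains x where "x \<in> V" "P x"
proof -
  have "AE x in lebesgue. x \<in> U \<longrightarrow> P x"
    using assms(1,2) by (simp add: AE_restrict_space_iff)
  then obtain N where N: "N \<in> null_sets lebesgue" "{x. \<not> (x \<in> U \<longrightarrow> P x)} \<subseteq> N"
    by (auto simp: eventually_ae_filter)
  have "\<not> V \<subseteq> N"
    using N(1) open_not_negligible[OF assms(3,5)] negligible_subset
    by (auto simp: negligible_iff_null_sets)
  then show ?thesis
    using N(2) assms(4) that by blast
qed

theorem corollary1:
  fixes F :: "real^'n \<Rightarrow> real^'m" and U :: "(real^'n) set"
  assumes "open U"
    and "C1_on F U"
    and "almost_constant_rank F U"
  shows "(AE p in lebesgue_on U. sol_set_robust F U p) \<or>
         (\<forall>p\<in>U. \<not> sol_set_robust F U p)"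
proof (rule disjCI)
  define V where "V = {x \<in> U. rank (jacobian F (at x)) = CARD('m)}"
  assume "\<not> (\<forall>p\<in>U. \<not> sol_set_robust F U p)"
  then have "V \<noteq> {}"
    by (auto simp: V_def sol_set_robust_def robust_point_def)
  moreover have "open V"
    unfolding V_def using assms(1,2) by (intro open_full_row_rank) (auto simp: C1_on_def)
  moreover have "V \<subseteq> U"
    by (auto simp: V_def)
  moreover obtain \<rho> where \<rho>: "AE x in lebesgue_on U. rank (jacobian F (at x)) = \<rho>"
    using assms(3) by (auto simp: almost_constant_rank_def)
  ultimately obtain x where "x \<in> V" "rank (jacobian F (at x)) = \<rho>"
    using AE_lebesgue_on_open_meets[OF \<rho> assms(1)] by blast
  then have "\<rho> = CARD('m)"
    by (simp add: V_def)
  \<comment> \<open>Robustness includes membership in \<open>U\<close>, which the rank condition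
    alone does not give.\<close>
  moreover have "AE x in lebesgue_on U. x \<in> U"
    by (rule AE_I2) (simp add: space_restrict_space)
  ultimately show "AE p in lebesgue_on U. sol_set_robust F U p"
    using \<rho> by (auto simp: sol_set_robust_def robust_point_def)
qed

end
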